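(* Let $\mathcal{M}$ be a meta-domain, and let $\mathcal{F}$ be a hypothesis space of polynomial-time problem solvers for domains in $\mathcal{M}$. Let $\dim(\mathcal{F}_n)=\log_2|\mathcal{F}_n|$ be polynomially bounded in $n$. Then an algorithm is a speedup learning algorithm for $\mathcal{M}$ in $\mathcal{F}$ if it 1. takes the specification of a domain $D\in\mathcal{M}$, $n$, $\epsilon$, and $\delta$ as inputs; 2. possibly calls the goals and operators in $D$; 3. collects $\frac{1}{\epsilon}\left(\dim(\mathcal{F}_n)\ln 2+\ln\frac{1}{\delta}\right)$ training examples (by calls to the oracle SOLVED-PROBLEM); 4. terminates in time polynomial in $n$, $\frac1\epsilon$, $\frac1\delta$, and in the sizes of the domain specification and the training examples; and 5. outputs a problem solver in $\mathcal{F}$ which is consistent with the training sample.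
   Context: **Domains.** Let $\Sigma=\{0,1\}$. A problem domain $D$ is a tuple $\langle S,G,O\rangle$, where $S=\Sigma^n$ is a set of states, $G$ is a procedure recognizing a subset of the states as goal states, and $O=\{o_1,\dots,o_k\}$ is a set of operators, each a procedure mapping a state in $S$ to a state $o_i(s)\in S$. The specification of $D$ is the combination of its goals and operators (given as procedures that can be called). A meta-domain is a set of domains defined over the same set of states. A problem is a state $s\in S$; its size is $|s|=n$. A problem $s$ is solvable if there are operators $o_{x_1},\dots,o_{x_d}$ and states $s_0=s,\ s_i=o_{x_i}(s_{i-1})$ with $s_d$ a goal state; then $(o_{x_1},\dots,o_{x_d})$ is a solution sequence of $s$, of length $d$. **Problem solvers.** A problem solver $f$ for a domain is a deterministic program that takes a problem as input and outputs a solution sequence of it, or the special symbol $\perp$ if it finds none. A hypothesis space $\mathcal{F}$ is a set of problem solvers. $\mathcal{F}_n$ is the set of restrictions of members of $\mathcal{F}$ to problems of size at most $n$ (restrictions $f_n(x)=f(x)$ if $|x|\le n$, undefined otherwise). A hypothesis space consists of polynomial-time problem solvers if there is a fixed polynomial bounding the running time of all its members in terms of the problem size $n$, the maximum solution length $L$, and an upper bound $t$ on the running time of the programs (goal and operators) in $D$ on inputs of size $n$. **Oracle and consistency.** Let $f\in\mathcal{F}$ be a target problem solver for $D$ and $P$ a probability distribution on $\Sigma^n$. Each call to the oracle SOLVED-PROBLEM draws $x$ independently with probability $P(x)$ and returns the pair $\langle x,f(x)\rangle$, called a training example (so the pair is $\langle x,\perp\rangle$ if $f$ does not solve $x$). A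 training sample is a set of training examples. A problem solver $h$ is consistent with a training sample if $h(\text{problem})=\text{solution}$ for every pair $\langle\text{problem},\text{solution}\rangle$ in it. **Speedup learning algorithm.** An algorithm $A$ is a speedup learning algorithm for a meta-domain $\mathcal{M}$ in a hypothesis space $\mathcal{F}$ if for any domain $D\in\mathcal{M}$, any problem distribution $P$ and any target problem solver $f\in\mathcal{F}$ for $D$: (1) $A$ takes as input the specification of $D$, a maximum problem size $n$, an error parameter $\epsilon$ and a confidence parameter $\delta$ (with $0<\epsilon,\delta<1$); (2) $A$ may call SOLVED-PROBLEM, which returns examples $\langle x,f(x)\rangle$ with $x$ chosen with probability $P(x)$ from $\Sigma^n$; the number of oracle calls is polynomial in $n,\frac1\epsilon,\frac1\delta$ and the length of its input; its running time is polynomial in all the previous parameters and an upper bound $t$ on the running times of the programs in $D$ on inputs of size $n$ (the length of the input includes the lengths of the examples received from the oracle); (3) for all $D\in\mathcal{M}$ and all probability distributions $P$ over $\Sigma^n$, with probability at least $1-\delta$, $A$ outputs a program $f'$ that approximates $f$ in the sense that $\sum_{x\in\Delta}P(x)\le\epsilon$, where $\Delta=\{x\mid f'(x)\ne f(x)\text{ and }f(x)\ne\perp\}$; (4) there is a fixed polynomial $R$ such that, with $L$ the maximum solution length (the maximum length of a solution output by the target $f$ on problems of size at most $n$), if $A$ outputs $f'$ then the run time of $f'$ is bounded by $R(n,L,t,\frac1\epsilon,\frac1\delta)$. Sample sizes are rounded up to integers. *)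

theory Defs
  imports "HOL-Probability.Probability" "HOL-Computational_Algebra.Polynomial"
begin

section \<open>Programs and their running times\<close>

text \<open>
  Programs are flowcharts over finitely many registers, each holding a stack of bits (a register is
  half a Turing machine tape, so running times agree with those of multi-tape Turing machines up to
  polynomials). \<open>Pop r i j k\<close> jumps to \<open>i\<close>, \<open>j\<close> or \<open>k\<close> when register \<open>r\<close> is empty, has top bit 0 or
  has top bit 1, and removes the top bit in the last two cases; on an unused register it is an
  unconditional jump. A program halts when the program counter leaves it. The input is
  placed in register 0, which also holds the result.
\<close>

type_synonym word = "bool list"

datatype instr = Push nat bool | Pop nat nat nat nat

type_synonym prog = "instr list"
type_synonym config = "nat \<times> (nat \<Rightarrow> word)"

fun exec :: "instr \<Rightarrow> config \<Rightarrow> config" where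
  "exec (Push r b) (pc, v) = (Suc pc, v(r := b # v r))"
| "exec (Pop r i j k) (pc, v) =
     (case v r of [] \<Rightarrow> (i, v) | b # w \<Rightarrow> (if b then k else j, v(r := w)))"

definition halted :: "prog \<Rightarrow> config \<Rightarrow> bool" where
  "halted p c \<longleftrightarrow> length p \<le> fst c"

definition step :: "prog \<Rightarrow> config \<Rightarrow> config" where
  "step p c = (if halted p c then c else exec (p ! fst c) c)"

definition after :: "prog \<Rightarrow> word \<Rightarrow> nat \<Rightarrow> config" where
  "after p x k = (step p ^^ k) (0, (\<lambda>_. [])(0 := x))"

definition halts :: "prog \<Rightarrow> word \<Rightarrow> bool" where
  "halts p x \<longleftrightarrow> (\<exists>k. halted p (after p x k))"

text \<open>The next two are meaningful only if \<open>halts p x\<close>.\<close>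

definition run_time :: "prog \<Rightarrow> word \<Rightarrow> nat" where
  "run_time p x = (LEAST k. halted p (after p x k))"

definition result :: "prog \<Rightarrow> word \<Rightarrow> word" where
  "result p x = snd (after p x (run_time p x)) 0"

definition accepts :: "prog \<Rightarrow> word \<Rightarrow> bool" where
  "accepts p x \<longleftrightarrow> halts p x \<and> result p x = [True]"


section \<open>Encodings as bit strings\<close>

fun bits :: "nat \<Rightarrow> word" where
  "bits n = (if n = 0 then [] else odd n # bits (n div 2))"

declare bits.simps [simp del]

text \<open>Lists of numbers are written in unary with terminators. They encode operator indices and
  program text only.\<close>

definition nats_code :: "nat list \<Rightarrow> word" where
  "nats_code ns = concat (map (\<lambda>n. replicate n True @ [False]) ns)"

fun instr_code :: "instr \<Rightarrow> nat list" where
  "instr_code (Push r b) = [0, r, of_bool b, 0, 0]"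
| "instr_code (Pop r i j k) = [1, r, i, j, k]"

definition program_code :: "prog \<Rightarrow> nat list" where
  "program_code p = length p # concat (map instr_code p)"

lemma nats_code_inj: "inj nats_code"
proof (rule injI)
  have key: "m = n \<and> u = w" 
    if "replicate m True @ False # u = replicate n True @ False # w" for m n :: nat and u w
    using that
  proof (induction m arbitrary: n)
    case 0
    then show ?case by (cases n) auto
  next
    case (Suc m)
    then show ?case by (cases n) auto
  qed
  show "xs = ys" if "nats_code xs = nats_code ys" for xs ys
    using that
  proof (induction xs arbitrary: ys)
    case Nil
    then show ?case by (cases ys) (auto simp: nats_code_def)
  next
    case (Cons x xs)
    then obtain y ys' where ys: "ys = y # ys'"
      by (cases ys) (simp_all add: nats_code_def)
    with Cons.prems have "x = y \<and> nats_code xs = nats_code ys'"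
      by (intro key) (simp add: nats_code_def)
    with Cons.IH ys show ?case by simp
  qed
qed

lemma instr_code_inj: "instr_code a = instr_code b \<longleftrightarrow> a = b"
  by (cases a; cases b) auto

lemma length_instr_code: "length (instr_code a) = 5"
  by (cases a) auto

lemma instr_code_nonempty: "instr_code a \<noteq> []" "[] \<noteq> instr_code a"
  by (cases a; simp)+

lemma program_code_inj: "inj program_code"
proof (rule injI)
  have "p = q" if "concat (map instr_code p) = concat (map instr_code q)" for p q
    using that
  proof (induction p arbitrary: q)
    case Nil
    then show ?case by (cases q) (simp_all add: instr_code_nonempty)
  next
    case (Cons a p)
    then obtain b q' where q: "q = b # q'"
      by (cases q) (simp_all add: instr_code_nonempty)
    with Cons.prems have "instr_code a = instr_code b \<and>
        concat (map instr_code p) = concat (map instr_code q')"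
      by (simp add: length_instr_code)
    with Cons.IH q show ?case by (simp add: instr_code_inj)
  qed
  then show "p = q" if "program_code p = program_code q" for p q
    using that by (auto simp: program_code_def)
qed


section \<open>Domains\<close>

text \<open>
  The goal recognizer and the operators are single programs that work on states of every size;
  for a given problem size \<open>n\<close> the set of states is the set of words of length \<open>n\<close>.
\<close>

record domain =
  goal :: prog
  operators :: "prog list"

definition domain_programs :: "domain \<Rightarrow> prog set" where
  "domain_programs D = insert (goal D) (set (operators D))"

definition valid_domain :: "domain \<Rightarrow> bool" where
  "valid_domain D \<longleftrightarrow>
     (\<forall>p\<in>domain_programs D. \<forall>s. halts p s) \<and>
     (\<forall>p\<in>set (operators D). \<forall>s. length (result p s) = length s)"

definition meta_domain :: "domain set \<Rightarrow> bool" where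
  "meta_domain M \<longleftrightarrow> (\<forall>D\<in>M. valid_domain D)"

definition domain_time_bound :: "domain \<Rightarrow> nat \<Rightarrow> nat \<Rightarrow> bool" where
  "domain_time_bound D n t \<longleftrightarrow>
     (\<forall>p\<in>domain_programs D. \<forall>s. length s = n \<longrightarrow> run_time p s \<le> t)"

definition domain_code :: "domain \<Rightarrow> nat list" where
  "domain_code D =
     length (operators D) # program_code (goal D) @ concat (map program_code (operators D))"

fun solution_sequence :: "domain \<Rightarrow> word \<Rightarrow> nat list \<Rightarrow> bool" where
  "solution_sequence D s [] = accepts (goal D) s"
| "solution_sequence D s (i # is) =
     (i < length (operators D) \<and> solution_sequence D (result (operators D ! i) s) is)"


section \<open>Problem solvers and hypothesis spaces\<close>

text \<open>\<open>Bottom\<close> is the special symbol output by a solver that finds no solution.\<close>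

datatype answer = Bottom | Solution "nat list"

fun answer_code :: "answer \<Rightarrow> word" where
  "answer_code Bottom = []"
| "answer_code (Solution is) = True # nats_code is"

lemma answer_code_inj: "inj answer_code"
proof (rule injI)
  show "a = b" if "answer_code a = answer_code b" for a b
    using that injD[OF nats_code_inj] by (cases a; cases b) auto
qed

text \<open>The partial function computed by a program; it is undefined where the program diverges
  or leaves a word that encodes no answer.\<close>

definition solver_fun :: "prog \<Rightarrow> word \<rightharpoonup> answer" where
  "solver_fun p x =
     (if halts p x \<and> result p x \<in> range answer_code
      then Some (inv answer_code (result p x)) else None)"

definition problem_solver :: "domain \<Rightarrow> prog \<Rightarrow> bool" where
  "problem_solver D f \<longleftrightarrow>
     (\<forall>s. solver_fun f s = Some Bottom \<or>
          (\<exists>is. solver_fun f s = Some (Solution is) \<and> solution_sequence D s is))"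

definition max_solution_length :: "prog \<Rightarrow> nat \<Rightarrow> nat" where
  "max_solution_length f n =
     Max (insert 0 {length is | is. \<exists>s. length s \<le> n \<and> solver_fun f s = Some (Solution is)})"

definition restricted_space :: "prog set \<Rightarrow> nat \<Rightarrow> (word \<rightharpoonup> answer) set" where
  "restricted_space F n = (\<lambda>f. solver_fun f |` {x. length x \<le> n}) ` F"

definition dim :: "(word \<rightharpoonup> answer) set \<Rightarrow> real" where
  "dim H = log 2 (real (card H))"

text \<open>Finiteness is spelled out because \<open>card\<close> is 0 on infinite sets.\<close>

definition polynomially_bounded_dim :: "prog set \<Rightarrow> bool" where
  "polynomially_bounded_dim F \<longleftrightarrow>
     (\<exists>q :: real poly. \<forall>n. finite (restricted_space F n) \<and>
        dim (restricted_space F n) \<le> poly q (real n))"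

text \<open>Polynomial functions of \<open>k\<close> real arguments (evaluated at lists of length \<open>k\<close>).\<close>

inductive polynomial :: "nat \<Rightarrow> (real list \<Rightarrow> real) \<Rightarrow> bool" for k where
  const: "polynomial k (\<lambda>v. c)"
| arg: "i < k \<Longrightarrow> polynomial k (\<lambda>v. v ! i)"
| add: "polynomial k p \<Longrightarrow> polynomial k q \<Longrightarrow> polynomial k (\<lambda>v. p v + q v)"
| mult: "polynomial k p \<Longrightarrow> polynomial k q \<Longrightarrow> polynomial k (\<lambda>v. p v * q v)"

definition hypothesis_space :: "domain set \<Rightarrow> prog set \<Rightarrow> bool" where
  "hypothesis_space M F \<longleftrightarrow> (\<forall>h\<in>F. \<exists>D\<in>M. problem_solver D h)"

text \<open>
  As for learning algorithms below, the maximum solution length is that of the target \<open>f\<close>. With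
  the maximum solution length of \<open>h\<close> itself instead, a hypothesis that differs from
  \<open>f\<close> only on a few problems could output much longer solutions there, and its running time would
  not be bounded in terms of the solution length of \<open>f\<close>.
\<close>

definition polynomial_time_solvers :: "domain set \<Rightarrow> prog set \<Rightarrow> bool" where
  "polynomial_time_solvers M F \<longleftrightarrow>
     (\<exists>Q. polynomial 3 Q \<and>
        (\<forall>D\<in>M. \<forall>f\<in>F. problem_solver D f \<longrightarrow>
           (\<forall>n t. domain_time_bound D n t \<longrightarrow>
              (\<forall>h\<in>F. \<forall>x. length x = n \<longrightarrow>
                 real (run_time h x) \<le> Q [real n, real (max_solution_length f n), real t]))))"


section \<open>Training examples\<close>

type_synonym example = "word \<times> answer"

definition example_size :: "example \<Rightarrow> nat" where
  "example_size e = length (fst e) + length (answer_code (snd e))"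

definition consistent :: "prog \<Rightarrow> example set \<Rightarrow> bool" where
  "consistent h S \<longleftrightarrow> (\<forall>(x, a)\<in>S. solver_fun h x = Some a)"

text \<open>The answers of the oracle for target \<open>f\<close>, where \<open>\<omega> i\<close> is the problem drawn in call \<open>i\<close>.\<close>

definition solved_problem :: "prog \<Rightarrow> (nat \<Rightarrow> word) \<Rightarrow> nat \<Rightarrow> example" where
  "solved_problem f \<omega> i = (\<omega> i, the (solver_fun f (\<omega> i)))"


section \<open>Learning algorithms\<close>

text \<open>
  A learning algorithm is a program with additional instructions:
  \<open>CallGoal q r\<close> runs the goal recognizer on register \<open>r\<close> and leaves the verdict in \<open>q\<close>;
  \<open>CallOperator q r\<close> applies to register \<open>r\<close> the operator whose index is the length of
  register \<open>q\<close>; \<open>SolvedProblem q r\<close> calls the oracle. Calls to programs of the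
  domain are charged with the running times of these programs.
\<close>

datatype linstr =
  Basic instr | CallGoal nat nat | CallOperator nat nat | SolvedProblem nat nat

type_synonym learner = "linstr list"

record lstate =
  pc :: nat
  regs :: "nat \<Rightarrow> word"
  calls :: nat
  time :: nat

fun lexec :: "domain \<Rightarrow> (nat \<Rightarrow> example) \<Rightarrow> linstr \<Rightarrow> lstate \<Rightarrow> lstate" where
  "lexec D ex (Basic i) s =
     (let (pc', v) = exec i (pc s, regs s)
      in s\<lparr>pc := pc', regs := v, time := time s + 1\<rparr>)"
| "lexec D ex (CallGoal q r) s =
     s\<lparr>pc := Suc (pc s),
       regs := (regs s)(q := [accepts (goal D) (regs s r)]),
       time := time s + 1 + run_time (goal D) (regs s r)\<rparr>"
| "lexec D ex (CallOperator q r) s =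
     (let i = length (regs s q) in
      if i < length (operators D)
      then s\<lparr>pc := Suc (pc s),
             regs := (regs s)(r := result (operators D ! i) (regs s r)),
             time := time s + 1 + run_time (operators D ! i) (regs s r)\<rparr>
      else s\<lparr>pc := Suc (pc s), time := time s + 1\<rparr>)"
| "lexec D ex (SolvedProblem q r) s =
     s\<lparr>pc := Suc (pc s),
       regs := (regs s)(q := fst (ex (calls s)), r := answer_code (snd (ex (calls s)))),
       calls := calls s + 1,
       time := time s + 1\<rparr>"

definition lhalted :: "learner \<Rightarrow> lstate \<Rightarrow> bool" where
  "lhalted A s \<longleftrightarrow> length A \<le> pc s"

definition lstep :: "learner \<Rightarrow> domain \<Rightarrow> (nat \<Rightarrow> example) \<Rightarrow> lstate \<Rightarrow> lstate" where
  "lstep A D ex s = (if lhalted A s then s else lexec D ex (A ! pc s) s)"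

text \<open>
  The inputs of a learner are the specification of the domain, the problem size and the parameters
  \<open>\<epsilon>\<close> and \<open>\<delta>\<close>, which must have finite representations and therefore are rational.
\<close>

definition linput :: "domain \<Rightarrow> nat \<Rightarrow> rat \<Rightarrow> rat \<Rightarrow> word list" where
  "linput D n \<epsilon> \<delta> =
     [nats_code (domain_code D), bits n,
      bits (nat (fst (quotient_of \<epsilon>))), bits (nat (snd (quotient_of \<epsilon>))),
      bits (nat (fst (quotient_of \<delta>))), bits (nat (snd (quotient_of \<delta>)))]"

definition input_size :: "domain \<Rightarrow> nat \<Rightarrow> rat \<Rightarrow> rat \<Rightarrow> nat" where
  "input_size D n \<epsilon> \<delta> = sum_list (map length (linput D n \<epsilon> \<delta>))"

definition linit :: "domain \<Rightarrow> nat \<Rightarrow> rat \<Rightarrow> rat \<Rightarrow> lstate" where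
  "linit D n \<epsilon> \<delta> =
     \<lparr>pc = 0,
      regs = (\<lambda>i. if i < length (linput D n \<epsilon> \<delta>) then linput D n \<epsilon> \<delta> ! i else []),
      calls = 0, time = 0\<rparr>"

text \<open>\<open>final A D f n \<epsilon> \<delta> \<omega> s\<close>: with target \<open>f\<close> and drawn problems \<open>\<omega>\<close>, the learner \<open>A\<close> halts
  in state \<open>s\<close>.\<close>

definition final ::
  "learner \<Rightarrow> domain \<Rightarrow> prog \<Rightarrow> nat \<Rightarrow> rat \<Rightarrow> rat \<Rightarrow> (nat \<Rightarrow> word) \<Rightarrow> lstate \<Rightarrow> bool" where
  "final A D f n \<epsilon> \<delta> \<omega> s \<longleftrightarrow>
     lhalted A s \<and> (\<exists>k. s = (lstep A D (solved_problem f \<omega>) ^^ k) (linit D n \<epsilon> \<delta>))"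

lemma final_unique:
  assumes "final A D f n \<epsilon> \<delta> \<omega> s" "final A D f n \<epsilon> \<delta> \<omega> s'"
  shows "s = s'"
proof -
  define st where "st = lstep A D (solved_problem f \<omega>)"
  define c where "c k = (st ^^ k) (linit D n \<epsilon> \<delta>)" for k
  have stuck: "(st ^^ j) u = u" if "lhalted A u" for j u
    by (induction j) (simp_all add: that st_def lstep_def)
  have mono: "c l = c k" if "k \<le> l" "lhalted A (c k)" for k l
  proof -
    have "(st ^^ l) = (st ^^ (l - k)) \<circ> (st ^^ k)"
      using that(1) by (simp flip: funpow_add)
    then have "c l = (st ^^ (l - k)) (c k)"
      by (simp add: c_def)
    then show ?thesis using stuck[OF that(2)] by simp
  qed
  obtain k where k: "s = c k" "lhalted A (c k)"
    using assms(1) unfolding final_def c_def st_def by blast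
  obtain l where l: "s' = c l" "lhalted A (c l)"
    using assms(2) unfolding final_def c_def st_def by blast
  show ?thesis
    unfolding k(1) l(1) using mono[OF _ k(2), of l] mono[OF _ l(2), of k]
    by (cases "k \<le> l") simp_all
qed

definition program_output :: "lstate \<Rightarrow> prog \<Rightarrow> bool" where
  "program_output s p \<longleftrightarrow> regs s 0 = nats_code (program_code p)"

definition training_sample :: "prog \<Rightarrow> (nat \<Rightarrow> word) \<Rightarrow> nat \<Rightarrow> example set" where
  "training_sample f \<omega> m = solved_problem f \<omega> ` {..<m}"

definition examples_size :: "prog \<Rightarrow> (nat \<Rightarrow> word) \<Rightarrow> nat \<Rightarrow> nat" where
  "examples_size f \<omega> m = (\<Sum>i<m. example_size (solved_problem f \<omega> i))"

definition approximates :: "word pmf \<Rightarrow> real \<Rightarrow> prog \<Rightarrow> prog \<Rightarrow> bool" where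
  "approximates P \<epsilon> f f' \<longleftrightarrow>
     measure_pmf.prob P {x. solver_fun f' x \<noteq> solver_fun f x \<and> solver_fun f x \<noteq> Some Bottom} \<le> \<epsilon>"

text \<open>
  The number of oracle calls is bounded in terms of the length of the initial input alone (a bound
  that may depend on the examples received would be void); the running time may also
  depend on the lengths of the examples received.
\<close>

definition speedup_learning_algorithm :: "domain set \<Rightarrow> prog set \<Rightarrow> learner \<Rightarrow> bool" where
  "speedup_learning_algorithm M F A \<longleftrightarrow>
     (\<exists>N T R. polynomial 4 N \<and> polynomial 5 T \<and> polynomial 5 R \<and>
       (\<forall>D\<in>M. \<forall>f\<in>F. problem_solver D f \<longrightarrow>
         (\<forall>n \<epsilon> \<delta>. 0 < \<epsilon> \<longrightarrow> \<epsilon> < 1 \<longrightarrow> 0 < \<delta> \<longrightarrow> \<delta> < 1 \<longrightarrow>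
           (\<forall>\<omega>. (\<forall>i. length (\<omega> i) = n) \<longrightarrow>
             (\<exists>s. final A D f n \<epsilon> \<delta> \<omega> s \<and>
               real (calls s) \<le>
                 N [real n, 1 / of_rat \<epsilon>, 1 / of_rat \<delta>, real (input_size D n \<epsilon> \<delta>)] \<and>
               (\<forall>t. domain_time_bound D n t \<longrightarrow>
                 real (time s) \<le>
                   T [real n, 1 / of_rat \<epsilon>, 1 / of_rat \<delta>,
                      real (input_size D n \<epsilon> \<delta> + examples_size f \<omega> (calls s)), real t] \<and>
                 (\<forall>f'. program_output s f' \<longrightarrow>
                   (\<forall>x. length x = n \<longrightarrow>
                     halts f' x \<and>
                     real (run_time f' x) \<le>
                       R [real n, real (max_solution_length f n), real t,
                          1 / of_rat \<epsilon>, 1 / of_rat \<delta>]))))) \<and>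
           (\<forall>P :: word pmf. set_pmf P \<subseteq> {x. length x = n} \<longrightarrow>
             measure (Pi\<^sub>M UNIV (\<lambda>_::nat. measure_pmf P))
               {\<omega>. \<exists>s f'. final A D f n \<epsilon> \<delta> \<omega> s \<and> program_output s f' \<and>
                          approximates P (of_rat \<epsilon>) f f'}
             \<ge> 1 - of_rat \<delta>))))"

definition sample_size :: "prog set \<Rightarrow> nat \<Rightarrow> real \<Rightarrow> real \<Rightarrow> nat" where
  "sample_size F n \<epsilon> \<delta> =
     nat \<lceil>1 / \<epsilon> * (dim (restricted_space F n) * ln 2 + ln (1 / \<delta>))\<rceil>"

end

theory Submission
  imports Defs
begin

text \<open>
  A hypothesis in \<open>F\<close> whose error exceeds \<open>\<epsilon>\<close> agrees with the target on \<open>m\<close> independent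
  examples with probability at most \<open>(1 - \<epsilon>)^m \<le> exp (- \<epsilon> m)\<close>. Only the restrictions to problems
  of size \<open>n\<close> matter, so by a union bound some such hypothesis is consistent with the sample with
  probability at most \<open>card F\<^sub>n * exp (- \<epsilon> m)\<close>, and the sample size makes this at most \<open>\<delta>\<close>.
\<close>

section \<open>Polynomials in several arguments\<close>

text \<open>Coefficients may be negative, so a polynomial bound need not be monotone. Replacing each
  constant by its absolute value gives a majorant that is monotone on nonnegative arguments, so an
  argument of a time bound can be enlarged.\<close>

lemma polynomial_majorant:
  assumes "polynomial k p"
  shows "\<exists>q. polynomial k q \<and>
           (\<forall>v w. (\<forall>i<k. 0 \<le> v ! i \<and> v ! i \<le> w ! i) \<longrightarrow> \<bar>p v\<bar> \<le> q w)"
  using assms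
proof induction
  case (const c)
  then show ?case
    by (intro exI[of _ "\<lambda>v. \<bar>c\<bar>"]) (simp add: polynomial.const)
next
  case (arg i)
  then show ?case
    by (intro exI[of _ "\<lambda>v. v ! i"]) (auto intro: polynomial.arg)
next
  case (add p p')
  then obtain q q' where
    q: "polynomial k q" "\<And>v w. \<forall>i<k. 0 \<le> v ! i \<and> v ! i \<le> w ! i \<Longrightarrow> \<bar>p v\<bar> \<le> q w" and
    q': "polynomial k q'" "\<And>v w. \<forall>i<k. 0 \<le> v ! i \<and> v ! i \<le> w ! i \<Longrightarrow> \<bar>p' v\<bar> \<le> q' w"
    by metis
  have "\<bar>p v + p' v\<bar> \<le> q w + q' w" if "\<forall>i<k. 0 \<le> v ! i \<and> v ! i \<le> w ! i" for v w
    using q(2)[OF that] q'(2)[OF that] by linarith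
  with q(1) q'(1) show ?case
    by (intro exI[of _ "\<lambda>v. q v + q' v"]) (auto intro: polynomial.add)
next
  case (mult p p')
  then obtain q q' where
    q: "polynomial k q" "\<And>v w. \<forall>i<k. 0 \<le> v ! i \<and> v ! i \<le> w ! i \<Longrightarrow> \<bar>p v\<bar> \<le> q w" and
    q': "polynomial k q'" "\<And>v w. \<forall>i<k. 0 \<le> v ! i \<and> v ! i \<le> w ! i \<Longrightarrow> \<bar>p' v\<bar> \<le> q' w"
    by metis
  have "\<bar>p v * p' v\<bar> \<le> q w * q' w" if "\<forall>i<k. 0 \<le> v ! i \<and> v ! i \<le> w ! i" for v w
    using q(2)[OF that] q'(2)[OF that] by (auto simp: abs_mult intro!: mult_mono)
  with q(1) q'(1) show ?case
    by (intro exI[of _ "\<lambda>v. q v * q' v"]) (auto intro: polynomial.mult)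
qed

text \<open>Used to select, repeat and reorder arguments, since the bounds in the hypotheses and in
  the conclusion take different argument lists.\<close>

lemma polynomial_compose:
  assumes "polynomial k p" and "\<And>i. i < k \<Longrightarrow> polynomial l (\<lambda>v. g v ! i)"
  shows "polynomial l (\<lambda>v. p (g v))"
  using assms(1) by induction (auto intro: polynomial.intros assms(2))

lemma polynomial_poly:
  assumes "i < k"
  shows "polynomial k (\<lambda>v. poly q (v ! i))"
  by (induction q) (auto intro!: polynomial.intros assms)

section \<open>Runs of a learner\<close>

text \<open>Makes events about the final state measurable: they are countable unions of events that are
  determined by finitely many draws.\<close>

lemma lstep_funpow_cong:
  assumes "\<forall>i<k. ex i = ex' i" and "calls s = 0"
  shows "(lstep A D ex ^^ k) s = (lstep A D ex' ^^ k) s \<and> calls ((lstep A D ex ^^ k) s) \<le> k"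
  using assms(1)
proof (induction k)
  case 0
  then show ?case using assms(2) by simp
next
  case (Suc k)
  define u where "u = (lstep A D ex ^^ k) s"
  from Suc have u: "(lstep A D ex' ^^ k) s = u" "calls u \<le> k"
    by (auto simp: u_def)
  \<comment> \<open>At most \<open>k\<close> calls have been made, so the next example has index
    below \<open>Suc k\<close>, where both sequences agree.\<close>
  have ex: "ex (calls u) = ex' (calls u)"
    using Suc.prems u(2) by auto
  have "lstep A D ex u = lstep A D ex' u \<and> calls (lstep A D ex u) \<le> Suc k"
  proof (cases "A ! pc u")
    case (Basic i)
    then show ?thesis using u(2) by (auto simp: lstep_def split: prod.split)
  qed (use u(2) ex in \<open>auto simp: lstep_def Let_def\<close>)
  then show ?case using u(1) by (metis funpow.simps(2) comp_apply u_def)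
qed

text \<open>Both encodings are injective. A bound on every program output by a run therefore reduces
  to a bound on one known output.\<close>

lemma program_output_unique:
  "program_output s p \<Longrightarrow> program_output s q \<Longrightarrow> p = q"
  using injD[OF nats_code_inj] injD[OF program_code_inj] by (metis program_output_def)

section \<open>Independent samples\<close>

text \<open>Over a countable type there are only countably many prefixes of length \<open>k\<close>,
  and each of them determines a measurable cylinder.\<close>

lemma sets_PiM_finitely_determined:
  fixes P :: "'a :: countable pmf"
  assumes "\<And>\<omega> \<omega>'. \<forall>i<k. \<omega> i = \<omega>' i \<Longrightarrow> Q \<omega> \<longleftrightarrow> Q \<omega>'"
  shows "{\<omega>. Q \<omega>} \<in> sets (Pi\<^sub>M UNIV (\<lambda>_::nat. measure_pmf P))"
proof -
  have "{\<omega>. Q \<omega>} =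
      (\<Union>l\<in>(\<lambda>\<omega>. map \<omega> [0..<k]) ` {\<omega>. Q \<omega>}. {\<omega>. \<forall>i<k. \<omega> i = l ! i})" (is "_ = ?U")
  proof (intro equalityI subsetI)
    fix \<omega> assume "\<omega> \<in> ?U"
    then obtain \<omega>' where \<omega>': "Q \<omega>'" "\<forall>i<k. \<omega> i = map \<omega>' [0..<k] ! i"
      by auto
    then have "\<forall>i<k. \<omega> i = \<omega>' i" by simp
    with \<omega>'(1) assms show "\<omega> \<in> {\<omega>. Q \<omega>}" by blast
  qed auto
  also have "\<dots> \<in> sets (Pi\<^sub>M UNIV (\<lambda>_::nat. measure_pmf P))"
  proof (intro sets.countable_UN'')
    fix l :: "'a list"
    have "{\<omega> \<in> space (Pi\<^sub>M UNIV (\<lambda>_::nat. measure_pmf P)). \<forall>i\<in>{..<k}. \<omega> i \<in> {l ! i}}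
        \<in> sets (Pi\<^sub>M UNIV (\<lambda>_::nat. measure_pmf P))"
      by measurable
    then show "{\<omega>. \<forall>i<k. \<omega> i = l ! i} \<in> sets (Pi\<^sub>M UNIV (\<lambda>_::nat. measure_pmf P))"
      by (simp add: space_PiM lessThan_def)
  qed auto
  finally show ?thesis .
qed

text \<open>This is the cylinder form for which the product measure is known. It holds for every
  \<open>P\<close> because the space of \<open>measure_pmf P\<close> is the whole type.\<close>

lemma avoid_eq_prod_emb:
  "{\<omega>. \<forall>i<m. \<omega> i \<notin> B} =
     prod_emb UNIV (\<lambda>_. measure_pmf P) {..<m} (Pi\<^sub>E {..<m} (\<lambda>_. - B))"
  by (auto simp: prod_emb_def space_PiM PiE_iff)

lemma sets_PiM_avoid:
  "{\<omega>. \<forall>i<m. \<omega> i \<notin> B} \<in> sets (Pi\<^sub>M UNIV (\<lambda>_::nat. measure_pmf P))"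
  by (subst avoid_eq_prod_emb[of _ _ P]) (rule sets_PiM_I; simp)

lemma prob_PiM_avoid:
  "measure (Pi\<^sub>M UNIV (\<lambda>_::nat. measure_pmf P)) {\<omega>. \<forall>i<m. \<omega> i \<notin> B} =
     (1 - measure_pmf.prob P B) ^ m"
proof -
  interpret product_prob_space "\<lambda>_::nat. measure_pmf P" UNIV
    by unfold_locales
  show ?thesis
    using measure_PiM_emb[of "{..<m}" "\<lambda>_. - B"] measure_pmf.prob_compl[of B P]
    by (simp add: Compl_eq_Diff_UNIV avoid_eq_prod_emb[of _ _ P])
qed

text \<open>Union bound over sets rather than hypotheses: hypotheses with the same error set are
  counted once.\<close>

lemma prob_PiM_avoid_some:
  assumes "finite \<B>" and "\<And>B. B \<in> \<B> \<Longrightarrow> \<epsilon> \<le> measure_pmf.prob P B"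
  shows "measure (Pi\<^sub>M UNIV (\<lambda>_::nat. measure_pmf P)) {\<omega>. \<exists>B\<in>\<B>. \<forall>i<m. \<omega> i \<notin> B}
     \<le> real (card \<B>) * exp (- (\<epsilon> * real m))"
proof -
  interpret prob_space "Pi\<^sub>M UNIV (\<lambda>_::nat. measure_pmf P)"
    by (intro prob_space_PiM measure_pmf.prob_space_axioms)
  let ?M = "Pi\<^sub>M UNIV (\<lambda>_::nat. measure_pmf P)"
  have "measure ?M {\<omega>. \<exists>B\<in>\<B>. \<forall>i<m. \<omega> i \<notin> B} = measure ?M (\<Union>B\<in>\<B>. {\<omega>. \<forall>i<m. \<omega> i \<notin> B})"
    by (rule arg_cong[where f = "measure ?M"]) auto
  also have "\<dots> \<le> (\<Sum>B\<in>\<B>. measure ?M {\<omega>. \<forall>i<m. \<omega> i \<notin> B})"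
    by (intro finite_measure_subadditive_finite assms(1)) (auto intro: sets_PiM_avoid)
  also have "\<dots> \<le> (\<Sum>B\<in>\<B>. exp (- (\<epsilon> * real m)))"
  proof (intro sum_mono)
    fix B assume "B \<in> \<B>"
    have "measure ?M {\<omega>. \<forall>i<m. \<omega> i \<notin> B} = (1 - measure_pmf.prob P B) ^ m"
      by (rule prob_PiM_avoid)
    \<comment> \<open>The base satisfies \<open>1 - prob B\<close> \<le>
      \<open>1 - \<epsilon>\<close> \<le> \<open>exp (- \<epsilon>)\<close>, and it is nonnegative,
      as monotonicity of powers requires.\<close>
    also have "\<dots> \<le> exp (- \<epsilon>) ^ m"
      using assms(2)[OF \<open>B \<in> \<B>\<close>] exp_ge_add_one_self[of "- \<epsilon>"]
      by (intro power_mono) (linarith | simp)+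
    also have "\<dots> = exp (- (\<epsilon> * real m))"
      by (simp flip: exp_of_nat_mult add: mult.commute)
    finally show "measure ?M {\<omega>. \<forall>i<m. \<omega> i \<notin> B} \<le> exp (- (\<epsilon> * real m))" .
  qed
  finally show ?thesis by simp
qed

text \<open>A learner is only known to behave well when all drawn problems have size
  \<open>n\<close>; this confines attention to such draws, up to a null set.\<close>

lemma AE_PiM_set_pmf:
  "AE \<omega> in Pi\<^sub>M UNIV (\<lambda>_::nat. measure_pmf P). \<forall>i. \<omega> i \<in> set_pmf P"
proof -
  have "AE \<omega> in Pi\<^sub>M UNIV (\<lambda>_::nat. measure_pmf P). \<omega> i \<in> set_pmf P" for i
    by (rule AE_PiM_component) (auto simp: AE_measure_pmf measure_pmf.prob_space_axioms)
  then show ?thesis by (simp add: AE_all_countable)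
qed

section \<open>Sample complexity\<close>

lemma dim_nonneg:
  assumes "finite H" "H \<noteq> {}"
  shows "0 \<le> dim H"
proof -
  have "1 \<le> card H" using assms by (simp add: Suc_leI card_gt_0_iff)
  then show ?thesis by (simp add: dim_def)
qed

lemma sample_size_failure_bound:
  assumes "finite (restricted_space F n)" "restricted_space F n \<noteq> {}" "0 < \<epsilon>" "0 < \<delta>"
  shows "real (card (restricted_space F n)) * exp (- (\<epsilon> * real (sample_size F n \<epsilon> \<delta>))) \<le> \<delta>"
proof -
  define c where "c = real (card (restricted_space F n))"
  have c: "0 < c" using assms by (simp add: c_def card_gt_0_iff)
  \<comment> \<open>The factor \<open>ln 2\<close> turns the binary logarithm in \<open>dim\<close>
    into \<open>ln c\<close>, and rounding up only helps.\<close>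
  have "1 / \<epsilon> * (ln c + ln (1 / \<delta>)) \<le> real (sample_size F n \<epsilon> \<delta>)"
    by (simp add: sample_size_def dim_def log_def c_def) linarith
  then have "ln c + ln (1 / \<delta>) \<le> \<epsilon> * real (sample_size F n \<epsilon> \<delta>)"
    using assms(3) by (simp add: field_simps)
  then have "- (\<epsilon> * real (sample_size F n \<epsilon> \<delta>)) \<le> ln (\<delta> / c)"
    using c assms(4) by (simp add: ln_div)
  then have "exp (- (\<epsilon> * real (sample_size F n \<epsilon> \<delta>))) \<le> \<delta> / c"
    using c assms(4) by (metis divide_pos_pos exp_le_cancel_iff exp_ln)
  then show ?thesis using c by (simp add: field_simps flip: c_def)
qed

text \<open>The estimate \<open>ln (1 / \<delta>)\<close> \<le> \<open>1 / \<delta>\<close> makes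
  the bound polynomial in \<open>1 / \<delta>\<close>; the final 1 pays for rounding up.\<close>

lemma sample_size_le:
  assumes "finite (restricted_space F n)" "restricted_space F n \<noteq> {}"
    and "dim (restricted_space F n) \<le> b" "0 < \<epsilon>" "0 < \<delta>" "\<delta> < 1"
  shows "real (sample_size F n \<epsilon> \<delta>) \<le> 1 / \<epsilon> * (b * ln 2 + 1 / \<delta>) + 1"
proof -
  define x where "x = 1 / \<epsilon> * (dim (restricted_space F n) * ln 2 + ln (1 / \<delta>))"
  have "0 \<le> ln (1 / \<delta>)" "ln (1 / \<delta>) \<le> 1 / \<delta>"
    using assms(5,6) ln_bound[of "1 / \<delta>"] by simp_all
  then have "0 \<le> x" and "x \<le> 1 / \<epsilon> * (b * ln 2 + 1 / \<delta>)"
    unfolding x_def using dim_nonneg[OF assms(1,2)] assms(3,4)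
    by (auto intro!: divide_right_mono add_mono mult_right_mono)
  \<comment> \<open>Since \<open>x\<close> is nonnegative, the conversion to \<open>nat\<close> does
    not truncate.\<close>
  moreover have "real (sample_size F n \<epsilon> \<delta>) \<le> x + 1"
    unfolding sample_size_def x_def[symmetric] using \<open>0 \<le> x\<close> by linarith
  ultimately show ?thesis by linarith
qed

section \<open>Consistent learners\<close>

text \<open>An error set depends only on the restriction of the hypothesis to size at most
  \<open>n\<close>. Hence there are at most \<open>card (restricted_space F n)\<close> error sets,
  even if \<open>F\<close> is infinite.\<close>

lemma prob_consistent_bad_hypothesis:
  assumes "finite (restricted_space F n)" "f \<in> F" "0 < \<epsilon>" "0 < \<delta>"
    and P: "set_pmf P \<subseteq> {x. length x = n}"
  defines "err \<equiv> \<lambda>h. {x. length x = n \<and> solver_fun h x \<noteq> solver_fun f x}"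
  shows "measure (Pi\<^sub>M UNIV (\<lambda>_::nat. measure_pmf P))
           {\<omega>. \<exists>B\<in>err ` {h\<in>F. \<epsilon> < measure_pmf.prob P (err h)}.
                  \<forall>i<sample_size F n \<epsilon> \<delta>. \<omega> i \<notin> B} \<le> \<delta>"
proof -
  define \<B> where "\<B> = err ` {h\<in>F. \<epsilon> < measure_pmf.prob P (err h)}"
  define G where "G g = {x. length x = n \<and> g x \<noteq> solver_fun f x}" for g
  have "err h = G (solver_fun h |` {x. length x \<le> n})" for h
    by (auto simp: err_def G_def restrict_map_def)
  then have sub: "\<B> \<subseteq> G ` restricted_space F n"
    by (auto simp: \<B>_def restricted_space_def)
  have fin: "finite \<B>" and card: "card \<B> \<le> card (restricted_space F n)"
    using sub assms(1) by (auto intro: finite_subset surj_card_le)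
  have "measure (Pi\<^sub>M UNIV (\<lambda>_::nat. measure_pmf P))
          {\<omega>. \<exists>B\<in>\<B>. \<forall>i<sample_size F n \<epsilon> \<delta>. \<omega> i \<notin> B}
        \<le> real (card \<B>) * exp (- (\<epsilon> * real (sample_size F n \<epsilon> \<delta>)))"
    by (rule prob_PiM_avoid_some[OF fin]) (auto simp: \<B>_def)
  also have "\<dots> \<le> real (card (restricted_space F n)) * exp (- (\<epsilon> * real (sample_size F n \<epsilon> \<delta>)))"
    using card by (intro mult_right_mono) auto
  also have "\<dots> \<le> \<delta>"
    \<comment> \<open>The target \<open>f\<close> itself witnesses that the restricted space is
      nonempty.\<close>
    using assms by (intro sample_size_failure_bound) (auto simp: restricted_space_def)
  finally show ?thesis unfolding \<B>_def .
qed

text \<open>Split by the number \<open>k\<close> of steps: the state after \<open>k\<close> steps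
  depends on the first \<open>k\<close> draws only, so \<open>Q\<close> can be arbitrary.\<close>

lemma sets_PiM_final:
  fixes P :: "word pmf"
  shows "{\<omega>. \<exists>s f'. final A D f n \<epsilon> \<delta> \<omega> s \<and> Q s f'}
     \<in> sets (Pi\<^sub>M UNIV (\<lambda>_::nat. measure_pmf P))"
proof -
  define st where "st \<omega> k = (lstep A D (solved_problem f \<omega>) ^^ k) (linit D n \<epsilon> \<delta>)" for \<omega> k
  have "{\<omega>. \<exists>s f'. final A D f n \<epsilon> \<delta> \<omega> s \<and> Q s f'} =
      (\<Union>k. {\<omega>. lhalted A (st \<omega> k) \<and> (\<exists>f'. Q (st \<omega> k) f')})"
    unfolding final_def st_def by auto
  also have "\<dots> \<in> sets (Pi\<^sub>M UNIV (\<lambda>_::nat. measure_pmf P))"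
  proof (rule sets.countable_UN''; (rule sets_PiM_finitely_determined)?)
    fix k and \<omega> \<omega>' :: "nat \<Rightarrow> word"
    assume "\<forall>i<k. \<omega> i = \<omega>' i"
    then have "st \<omega> k = st \<omega>' k"
      unfolding st_def
      by (intro lstep_funpow_cong[THEN conjunct1]) (auto simp: solved_problem_def linit_def)
    then show "(lhalted A (st \<omega> k) \<and> (\<exists>f'. Q (st \<omega> k) f')) \<longleftrightarrow>
        (lhalted A (st \<omega>' k) \<and> (\<exists>f'. Q (st \<omega>' k) f'))"
      by simp
  qed auto
  finally show ?thesis .
qed

text \<open>A consistent output misses its own error set in all draws. If no error set of
  probability above \<epsilon> is missed by the whole sample, the output has error at most
  \<epsilon>.\<close>

lemma prob_learner_approximates:
  fixes P :: "word pmf"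
  assumes "finite (restricted_space F n)" "f \<in> F" "problem_solver D f"
    and "0 < \<epsilon>" "0 < \<delta>" "set_pmf P \<subseteq> {x. length x = n}"
    and learner: "\<And>\<omega>. \<forall>i. length (\<omega> i) = n \<Longrightarrow>
      \<exists>s. final A D f n \<epsilon> \<delta> \<omega> s \<and> calls s = sample_size F n (of_rat \<epsilon>) (of_rat \<delta>) \<and>
        (\<exists>h\<in>F. program_output s h \<and> consistent h (training_sample f \<omega> (calls s)))"
  shows "1 - of_rat \<delta> \<le> measure (Pi\<^sub>M UNIV (\<lambda>_::nat. measure_pmf P))
      {\<omega>. \<exists>s f'. final A D f n \<epsilon> \<delta> \<omega> s \<and> program_output s f' \<and>
                 approximates P (of_rat \<epsilon>) f f'}"
proof -
  let ?M = "Pi\<^sub>M UNIV (\<lambda>_::nat. measure_pmf P)"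
  let ?good = "{\<omega>. \<exists>s f'. final A D f n \<epsilon> \<delta> \<omega> s \<and> program_output s f' \<and>
                          approximates P (of_rat \<epsilon>) f f'}"
  interpret prob_space ?M
    by (intro prob_space_PiM measure_pmf.prob_space_axioms)
  define m where "m = sample_size F n (of_rat \<epsilon>) (of_rat \<delta>)"
  define err where "err h = {x. length x = n \<and> solver_fun h x \<noteq> solver_fun f x}" for h
  define \<B> where "\<B> = err ` {h\<in>F. of_rat \<epsilon> < measure_pmf.prob P (err h)}"
  \<comment> \<open>Essential for a lower bound, as \<open>measure\<close> is 0 on non-measurable
    sets.\<close>
  have good: "?good \<in> sets ?M"
    by (rule sets_PiM_final)
  have bad: "{\<omega>. \<exists>B\<in>\<B>. \<forall>i<m. \<omega> i \<notin> B} \<in> sets ?M"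
  proof (rule sets_PiM_finitely_determined)
    show "(\<exists>B\<in>\<B>. \<forall>i<m. \<omega> i \<notin> B) \<longleftrightarrow> (\<exists>B\<in>\<B>. \<forall>i<m. \<omega>' i \<notin> B)"
      if "\<forall>i<m. \<omega> i = \<omega>' i" for \<omega> \<omega>' :: "nat \<Rightarrow> word"
      using that by auto
  qed
  have "\<omega> \<in> ?good" if \<omega>: "\<forall>i. \<omega> i \<in> set_pmf P" "\<not> (\<exists>B\<in>\<B>. \<forall>i<m. \<omega> i \<notin> B)" for \<omega>
  proof -
    have len: "\<forall>i. length (\<omega> i) = n" using \<omega>(1) assms(6) by blast
    from learner[OF len] obtain s h where s: "final A D f n \<epsilon> \<delta> \<omega> s" "calls s = m"
      and h: "h \<in> F" "program_output s h" "consistent h (training_sample f \<omega> m)"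
      unfolding m_def by metis
    have "\<omega> i \<notin> err h" if "i < m" for i
    proof -
      have "solver_fun h (\<omega> i) = Some (the (solver_fun f (\<omega> i)))"
        using h(3) that by (auto simp: consistent_def training_sample_def solved_problem_def)
      \<comment> \<open>A problem solver answers on every input, so \<open>the\<close> never meets
        \<open>None\<close>.\<close>
      also have "\<dots> = solver_fun f (\<omega> i)"
        using assms(3) by (metis option.sel problem_solver_def)
      finally show ?thesis by (simp add: err_def)
    qed
    then have "measure_pmf.prob P (err h) \<le> of_rat \<epsilon>"
      using \<omega>(2) h(1) by (force simp: \<B>_def)
    \<comment> \<open>Inclusion in \<open>err h\<close> holds only almost surely:
      \<open>err h\<close> is limited to words of length \<open>n\<close>, which carry all the mass
      of \<open>P\<close>.\<close>
    moreover have "measure_pmf.prob P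
        {x. solver_fun h x \<noteq> solver_fun f x \<and> solver_fun f x \<noteq> Some Bottom}
      \<le> measure_pmf.prob P (err h)"
      using assms(6)
      by (intro measure_pmf.finite_measure_mono_AE) (auto simp: AE_measure_pmf_iff err_def)
    ultimately have "approximates P (of_rat \<epsilon>) f h"
      by (simp add: approximates_def)
    with s(1) h(2) show ?thesis by blast
  qed
  then have "AE \<omega> in ?M. \<omega> \<in> space ?M - {\<omega>. \<exists>B\<in>\<B>. \<forall>i<m. \<omega> i \<notin> B} \<longrightarrow> \<omega> \<in> ?good"
    by (intro AE_mp[OF AE_PiM_set_pmf AE_I2]) blast
  then have "measure ?M (space ?M - {\<omega>. \<exists>B\<in>\<B>. \<forall>i<m. \<omega> i \<notin> B}) \<le> measure ?M ?good"
    using good by (rule finite_measure_mono_AE)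
  moreover have "measure ?M {\<omega>. \<exists>B\<in>\<B>. \<forall>i<m. \<omega> i \<notin> B} \<le> of_rat \<delta>"
    using prob_consistent_bad_hypothesis[OF assms(1,2) _ _ assms(6), of "of_rat \<epsilon>" "of_rat \<delta>"] assms(4,5)
    by (simp add: \<B>_def m_def err_def)
  ultimately show ?thesis
    using prob_compl[OF bad] by linarith
qed

text \<open>The first two conditions on the algorithm are built into the type
  \<open>learner\<close>: its registers start with the specification and the parameters, and it has
  instructions that call the goal and the operators. The explicit assumption covers sample size,
  running time and consistent output.\<close>

theorem theorem1:
  fixes M :: "domain set" and F :: "prog set" and A :: learner
  assumes "meta_domain M"
    and "hypothesis_space M F"
    and "polynomial_time_solvers M F"
    and "polynomially_bounded_dim F"
    and "\<exists>T. polynomial 5 T \<and>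
      (\<forall>D\<in>M. \<forall>f\<in>F. problem_solver D f \<longrightarrow>
        (\<forall>n \<epsilon> \<delta>. 0 < \<epsilon> \<longrightarrow> \<epsilon> < 1 \<longrightarrow> 0 < \<delta> \<longrightarrow> \<delta> < 1 \<longrightarrow>
          (\<forall>\<omega>. (\<forall>i. length (\<omega> i) = n) \<longrightarrow>
            (\<exists>s. final A D f n \<epsilon> \<delta> \<omega> s \<and>
              calls s = sample_size F n (of_rat \<epsilon>) (of_rat \<delta>) \<and>
              real (time s) \<le>
                T [real n, 1 / of_rat \<epsilon>, 1 / of_rat \<delta>, real (input_size D n \<epsilon> \<delta>),
                   real (examples_size f \<omega> (calls s))] \<and>
              (\<exists>h\<in>F. program_output s h \<and>
                     consistent h (training_sample f \<omega> (calls s)))))))"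
  shows "speedup_learning_algorithm M F A"
proof -
  obtain q where q: "\<And>n. finite (restricted_space F n)"
      "\<And>n. dim (restricted_space F n) \<le> poly q (real n)"
    using assms(4) unfolding polynomially_bounded_dim_def by blast
  obtain Q where Q: "polynomial 3 Q"
      "\<And>D f n t h x. \<lbrakk>D \<in> M; f \<in> F; problem_solver D f; domain_time_bound D n t; h \<in> F;
         length x = n\<rbrakk> \<Longrightarrow>
         real (run_time h x) \<le> Q [real n, real (max_solution_length f n), real t]"
    using assms(3) unfolding polynomial_time_solvers_def by blast
  obtain T where T: "polynomial 5 T" and learner:
      "\<And>D f n \<epsilon> \<delta> \<omega>. \<lbrakk>D \<in> M; f \<in> F; problem_solver D f; 0 < \<epsilon>; \<epsilon> < 1; 0 < \<delta>; \<delta> < 1;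
         \<forall>i. length (\<omega> i) = n\<rbrakk> \<Longrightarrow>
         \<exists>s. final A D f n \<epsilon> \<delta> \<omega> s \<and>
           calls s = sample_size F n (of_rat \<epsilon>) (of_rat \<delta>) \<and>
           real (time s) \<le>
             T [real n, 1 / of_rat \<epsilon>, 1 / of_rat \<delta>, real (input_size D n \<epsilon> \<delta>),
                real (examples_size f \<omega> (calls s))] \<and>
           (\<exists>h\<in>F. program_output s h \<and> consistent h (training_sample f \<omega> (calls s)))"
    using assms(5) by (elim exE conjE) (rule that, assumption, blast)
  obtain T' where T': "polynomial 5 T'"
      "\<And>v w. \<forall>i<5. 0 \<le> v ! i \<and> v ! i \<le> w ! i \<Longrightarrow> \<bar>T v\<bar> \<le> T' w"
    using polynomial_majorant[OF T] by blast
  \<comment> \<open>A bound on \<open>run_time\<close> means nothing for a diverging program. Each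
    hypothesis solves some domain of \<open>M\<close>, so it halts everywhere.\<close>
  have halts: "halts h x" if "h \<in> F" for h x
  proof -
    obtain D where "problem_solver D h"
      using \<open>h \<in> F\<close> assms(2) by (auto simp: hypothesis_space_def)
    then have "solver_fun h x \<noteq> None"
      unfolding problem_solver_def by (metis option.distinct(1))
    then show ?thesis by (auto simp: solver_fun_def split: if_splits)
  qed
  \<comment> \<open>The bound of \<open>sample_size_le\<close>, with \<open>v ! 0\<close>,
    \<open>v ! 1\<close>, \<open>v ! 2\<close> standing for \<open>n\<close>,
    \<open>1 / \<epsilon>\<close>, \<open>1 / \<delta>\<close>.\<close>
  define N where "N v = v ! 1 * (poly q (v ! 0) * ln 2 + v ! 2) + 1" for v :: "real list"
  \<comment> \<open>The assumed bound takes input size and example size separately, the required one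
    takes their sum. The sum dominates both and fills both places of the monotone
    \<open>T'\<close>.\<close>
  define Tb where "Tb v = T' [v ! 0, v ! 1, v ! 2, v ! 3, v ! 3]" for v :: "real list"
  define R where "R v = Q [v ! 0, v ! 1, v ! 2]" for v :: "real list"
  have "polynomial 4 N"
    unfolding N_def by (intro polynomial.intros polynomial_poly) auto
  moreover have "polynomial 5 Tb"
    unfolding Tb_def
    by (rule polynomial_compose[OF T'(1)])
      (auto simp: less_Suc_eq numeral_eq_Suc intro!: polynomial.arg)
  moreover have "polynomial 5 R"
    unfolding R_def
    by (rule polynomial_compose[OF Q(1)])
      (auto simp: less_Suc_eq numeral_eq_Suc intro!: polynomial.arg)
  moreover have "\<exists>s. final A D f n \<epsilon> \<delta> \<omega> s \<and>
      real (calls s) \<le> N [real n, 1 / of_rat \<epsilon>, 1 / of_rat \<delta>, real (input_size D n \<epsilon> \<delta>)] \<and>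
      (\<forall>t. domain_time_bound D n t \<longrightarrow>
        real (time s) \<le>
          Tb [real n, 1 / of_rat \<epsilon>, 1 / of_rat \<delta>,
             real (input_size D n \<epsilon> \<delta> + examples_size f \<omega> (calls s)), real t] \<and>
        (\<forall>f'. program_output s f' \<longrightarrow>
          (\<forall>x. length x = n \<longrightarrow> halts f' x \<and>
            real (run_time f' x) \<le>
              R [real n, real (max_solution_length f n), real t,
                 1 / of_rat \<epsilon>, 1 / of_rat \<delta>])))"
    if D: "D \<in> M" "f \<in> F" "problem_solver D f"
      and \<epsilon>\<delta>: "0 < \<epsilon>" "\<epsilon> < 1" "0 < \<delta>" "\<delta> < 1" and \<omega>: "\<forall>i. length (\<omega> i) = n"
    for D f n \<epsilon> \<delta> \<omega>
  proof -
    obtain s h where s: "final A D f n \<epsilon> \<delta> \<omega> s"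
        "calls s = sample_size F n (of_rat \<epsilon>) (of_rat \<delta>)"
        "real (time s) \<le>
             T [real n, 1 / of_rat \<epsilon>, 1 / of_rat \<delta>, real (input_size D n \<epsilon> \<delta>),
                real (examples_size f \<omega> (calls s))]"
      and h: "h \<in> F" "program_output s h"
      using learner[OF D \<epsilon>\<delta> \<omega>] by blast
    have "real (calls s) \<le>
        N [real n, 1 / of_rat \<epsilon>, 1 / of_rat \<delta>, real (input_size D n \<epsilon> \<delta>)]"
      unfolding s(2) N_def
      using sample_size_le[OF q(1) _ q(2), of n "of_rat \<epsilon>" "of_rat \<delta>"] D(2) \<epsilon>\<delta>
      by (auto simp: restricted_space_def)
    moreover have "real (time s) \<le>
          Tb [real n, 1 / of_rat \<epsilon>, 1 / of_rat \<delta>,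
             real (input_size D n \<epsilon> \<delta> + examples_size f \<omega> (calls s)), real t]" for t
    proof -
      have "\<bar>T [real n, 1 / of_rat \<epsilon>, 1 / of_rat \<delta>, real (input_size D n \<epsilon> \<delta>),
                real (examples_size f \<omega> (calls s))]\<bar> \<le>
          Tb [real n, 1 / of_rat \<epsilon>, 1 / of_rat \<delta>,
             real (input_size D n \<epsilon> \<delta> + examples_size f \<omega> (calls s)), real t]"
        unfolding Tb_def using \<epsilon>\<delta>
        by (intro T'(2)) (auto simp: less_Suc_eq numeral_eq_Suc)
      with s(3) show ?thesis by linarith
    qed
    moreover have "f' = h" if "program_output s f'" for f'
      using program_output_unique[OF that h(2)] .
    \<comment> \<open>The bound \<open>Q\<close> applies to the output \<open>h\<close> with the
      maximum solution length of the target \<open>f\<close>, as \<open>R\<close> demands.\<close>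
    ultimately show ?thesis
      using s(1) halts[OF h(1)] Q(2)[OF D _ h(1)]
      by (intro exI[of _ s]) (auto simp: R_def)
  qed
  moreover have "1 - of_rat \<delta> \<le> measure (Pi\<^sub>M UNIV (\<lambda>_::nat. measure_pmf P))
      {\<omega>. \<exists>s f'. final A D f n \<epsilon> \<delta> \<omega> s \<and> program_output s f' \<and>
                 approximates P (of_rat \<epsilon>) f f'}"
    if "D \<in> M" "f \<in> F" "problem_solver D f" "0 < \<epsilon>" "\<epsilon> < 1" "0 < \<delta>" "\<delta> < 1"
      and "set_pmf P \<subseteq> {x. length x = n}"
    for D f n \<epsilon> \<delta> and P :: "word pmf"
  proof (rule prob_learner_approximates[OF q(1) that(2,3,4,6,8)])
    show "\<exists>s. final A D f n \<epsilon> \<delta> \<omega> s \<and> calls s = sample_size F n (of_rat \<epsilon>) (of_rat \<delta>) \<and>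
        (\<exists>h\<in>F. program_output s h \<and> consistent h (training_sample f \<omega> (calls s)))"
      if "\<forall>i. length (\<omega> i) = n" for \<omega>
      using learner[OF \<open>D \<in> M\<close> \<open>f \<in> F\<close> \<open>problem_solver D f\<close> \<open>0 < \<epsilon>\<close> \<open>\<epsilon> < 1\<close> \<open>0 < \<delta>\<close> \<open>\<delta> < 1\<close> that]
      by metis
  qed
  ultimately show ?thesis
    unfolding speedup_learning_algorithm_def
    by (intro exI[of _ N] exI[of _ Tb] exI[of _ R] conjI ballI impI allI) assumption+
qed

end
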